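(* Let $\theta\in[\lambda_{k+1},\lambda_k]$ and let $F_\theta=I_n+\sum_{i=1}^k\big(\frac{\theta}{\lambda_i}-1\big)s_is_i^\top$ be the preconditioner built from the $k$ largest eigenvalues of $A$. Then $$\|x^\ast-\hat x_\ell(F_\theta)\|_A\le\|x^\ast-x_\ell\|_A,$$ where $x_\ell$ is the $\ell$-th iterate of the (unpreconditioned) conjugate gradient method applied to $Ax=b$ starting from $x_0$.
   Context: $A\in\mathbb{R}^{n\times n}$ is symmetric positive definite with spectral decomposition $A=S\Lambda S^\top$, $\Lambda=\mathrm{diag}(\lambda_1,\dots,\lambda_n)$, $\lambda_1\ge\dots\ge\lambda_n>0$, $S=[s_1\ \cdots\ s_n]$ orthogonal. $b\in\mathbb{R}^n$, $x^\ast=A^{-1}b$, $x_0\in\mathbb{R}^n$ is an initial guess. $\|x\|_A=\sqrt{x^\top A x}$. $k$ is an integer with $1<k<n$. Exact arithmetic is assumed. The paper works here in the case $j_0=k+1$ for some $j_0\in\arg\min_{1\le j\le k+1}\lambda_j/\lambda_{n-k+j-1}$, in which the set of eigenvalue indices used by the preconditioner is $\pi_k^a=\{1,\dots,k\}$. Feasible preconditioner: $F=I_n+SDS^\top$ with $D=\mathrm{diag}(d_1,\dots,d_n)$ real, $I_n+D$ positive definite and $\mathrm{rank}(D)\le k$. $\mathbf{PCG}(F)$ is the preconditioned conjugate gradient method for $Ax=b$ with preconditioner $F$: $\hat x_0=x_0$, $\hat r_0=b-A\hat x_0$, $z_0=F\hat r_0$, $\hat\rho_0=\hat r_0^\top z_0$,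 $\hat p_0=z_0$, and for $\ell=0,1,\dots$: $\hat q_\ell=A\hat p_\ell$, $\hat\alpha_\ell=\hat\rho_\ell/(\hat q_\ell^\top\hat p_\ell)$, $\hat x_{\ell+1}=\hat x_\ell+\hat\alpha_\ell\hat p_\ell$, $\hat r_{\ell+1}=\hat r_\ell-\hat\alpha_\ell\hat q_\ell$, $z_{\ell+1}=F\hat r_{\ell+1}$, $\hat\rho_{\ell+1}=\hat r_{\ell+1}^\top z_{\ell+1}$, $\hat\beta_{\ell+1}=\hat\rho_{\ell+1}/\hat\rho_\ell$, $\hat p_{\ell+1}=z_{\ell+1}+\hat\beta_{\ell+1}\hat p_\ell$; it stops once the solution is reached. $\hat x_\ell(F)$ denotes its $\ell$-th iterate. The conjugate gradient (CG) method is the case $F=I_n$, with iterates $x_\ell$. Standing assumption: $\ell\ge1$ is fixed and, for every feasible $F$, $\mathbf{PCG}(F)$ has not reached the solution at iteration $\ell$ (the iterates up to $\ell$ are defined and $\hat x_j(F)\ne x^\ast$ for $j\le\ell$). *)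

theory Defs
  imports "HOL-Analysis.Analysis"
begin

definition pos_def_matrix :: "real ^ 'n ^ 'n \<Rightarrow> bool" where
  "pos_def_matrix M \<longleftrightarrow> transpose M = M \<and> (\<forall>x. x \<noteq> 0 \<longrightarrow> x \<bullet> (M *v x) > 0)"

definition diag_matrix :: "real ^ 'n \<Rightarrow> real ^ 'n ^ 'n" where
  "diag_matrix d = (\<chi> i j. if i = j then d $ i else 0)"

definition norm_wrt :: "real ^ 'n ^ 'n \<Rightarrow> real ^ 'n \<Rightarrow> real" where
  "norm_wrt A x = sqrt (x \<bullet> (A *v x))"

definition outer_prod :: "real ^ 'n \<Rightarrow> real ^ 'n \<Rightarrow> real ^ 'n ^ 'n" where
  "outer_prod u v = (\<chi> i j. u $ i * v $ j)"

(* Coordinates are indexed by a finite type 'n with n = CARD('n) elements. An enumeration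
   e : {1..n} -> 'n labels them by 1, ..., n, so that the i-th eigenvalue is lam $ e i and the
   i-th eigenvector s_i is column (e i) S. *)

definition ordered_spectral_decomp ::
  "real ^ 'n ^ 'n \<Rightarrow> real ^ 'n ^ 'n \<Rightarrow> real ^ 'n \<Rightarrow> (nat \<Rightarrow> 'n) \<Rightarrow> bool" where
  "ordered_spectral_decomp A S lam e \<longleftrightarrow>
     bij_betw e {1..CARD('n)} UNIV \<and>
     orthogonal_matrix S \<and>
     A = S ** diag_matrix lam ** transpose S \<and>
     (\<forall>i j. 1 \<le> i \<and> i \<le> j \<and> j \<le> CARD('n) \<longrightarrow> lam $ e j \<le> lam $ e i) \<and>
     (\<forall>i. lam $ i > 0)"

definition feasible_precond :: "real ^ 'n ^ 'n \<Rightarrow> nat \<Rightarrow> real ^ 'n ^ 'n \<Rightarrow> bool" where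
  "feasible_precond S k F \<longleftrightarrow>
     (\<exists>d. F = mat 1 + S ** diag_matrix d ** transpose S \<and>
          pos_def_matrix (mat 1 + diag_matrix d) \<and>
          rank (diag_matrix d) \<le> k)"

definition scaled_precond ::
  "real ^ 'n ^ 'n \<Rightarrow> real ^ 'n \<Rightarrow> (nat \<Rightarrow> 'n) \<Rightarrow> nat \<Rightarrow> real \<Rightarrow> real ^ 'n ^ 'n" where
  "scaled_precond S lam e k \<theta> =
     mat 1 + (\<Sum>i = 1..k. (\<theta> / lam $ e i - 1) *\<^sub>R
                outer_prod (column (e i) S) (column (e i) S))"

(* A PCG state consists of x_l, r_l, rho_l, p_l. The recurrence is not stopped explicitly: once
   r_l = 0, division by zero being 0, all later steps leave x_l unchanged. *)

type_synonym 'n pcg_state = "(real ^ 'n) \<times> (real ^ 'n) \<times> real \<times> (real ^ 'n)"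

definition pcg_init ::
  "real ^ 'n ^ 'n \<Rightarrow> real ^ 'n \<Rightarrow> real ^ 'n \<Rightarrow> real ^ 'n ^ 'n \<Rightarrow> 'n pcg_state" where
  "pcg_init A b x0 F = (let r = b - A *v x0; z = F *v r in (x0, r, r \<bullet> z, z))"

definition pcg_step ::
  "real ^ 'n ^ 'n \<Rightarrow> real ^ 'n ^ 'n \<Rightarrow> 'n pcg_state \<Rightarrow> 'n pcg_state" where
  "pcg_step A F = (\<lambda>(x, r, \<rho>, p).
     let q = A *v p;
         \<alpha> = \<rho> / (q \<bullet> p);
         x' = x + \<alpha> *\<^sub>R p;
         r' = r - \<alpha> *\<^sub>R q;
         z' = F *v r';
         \<rho>' = r' \<bullet> z';
         \<beta> = \<rho>' / \<rho>
     in (x', r', \<rho>', z' + \<beta> *\<^sub>R p))"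

definition pcg ::
  "real ^ 'n ^ 'n \<Rightarrow> real ^ 'n \<Rightarrow> real ^ 'n \<Rightarrow> real ^ 'n ^ 'n \<Rightarrow> nat \<Rightarrow> 'n pcg_state" where
  "pcg A b x0 F l = (pcg_step A F ^^ l) (pcg_init A b x0 F)"

definition pcg_iterate ::
  "real ^ 'n ^ 'n \<Rightarrow> real ^ 'n \<Rightarrow> real ^ 'n \<Rightarrow> real ^ 'n ^ 'n \<Rightarrow> nat \<Rightarrow> real ^ 'n" where
  "pcg_iterate A b x0 F l = fst (pcg A b x0 F l)"

definition cg_iterate ::
  "real ^ 'n ^ 'n \<Rightarrow> real ^ 'n \<Rightarrow> real ^ 'n \<Rightarrow> nat \<Rightarrow> real ^ 'n" where
  "cg_iterate A b x0 = pcg_iterate A b x0 (mat 1)"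

definition pcg_iterates_defined ::
  "real ^ 'n ^ 'n \<Rightarrow> real ^ 'n \<Rightarrow> real ^ 'n \<Rightarrow> real ^ 'n ^ 'n \<Rightarrow> nat \<Rightarrow> bool" where
  "pcg_iterates_defined A b x0 F l \<longleftrightarrow>
     (\<forall>j<l. case pcg A b x0 F j of (x, r, \<rho>, p) \<Rightarrow> (A *v p) \<bullet> p \<noteq> 0 \<and> \<rho> \<noteq> 0)"

definition pcg_not_converged ::
  "real ^ 'n ^ 'n \<Rightarrow> real ^ 'n \<Rightarrow> real ^ 'n \<Rightarrow> real ^ 'n ^ 'n \<Rightarrow> nat \<Rightarrow> bool" where
  "pcg_not_converged A b x0 F l \<longleftrightarrow>
     pcg_iterates_defined A b x0 F l \<and>
     (\<forall>j\<le>l. pcg_iterate A b x0 F j \<noteq> matrix_inv A *v b)"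

end

theory Submission
  imports Defs "HOL-Computational_Algebra.Fundamental_Theorem_Algebra"
begin

text \<open>
  The \<open>l\<close>-th CG error is \<open>q(A)\<close> applied to the initial error, for a polynomial \<open>q\<close> of degree at
  most \<open>l\<close> with \<open>q(0) = 1\<close> (lemma \<open>error_poly\<close>). The preconditioned error is minimal in the
  \<open>A\<close>-norm among all \<open>p(F A)\<close> applied to the initial error, where \<open>p\<close> is such a
  polynomial with real roots only (lemma \<open>error_minimal\<close>). In the basis of eigenvectors \<open>s\<^sub>i\<close>, the operator
  \<open>F\<^sub>\<theta> A\<close> has the eigenvalue \<open>\<theta>\<close> for \<open>i \<le> k\<close> and keeps the eigenvalue \<open>\<lambda>\<^sub>i \<le> \<theta>\<close> for
  \<open>i > k\<close>. Since the squared \<open>A\<close>-norm is a weighted sum of squares of the coordinates, the theorem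
  follows from a \<open>p\<close> with \<open>\<bar>p(\<lambda>\<^sub>i)\<bar> \<le> \<bar>q(\<lambda>\<^sub>i)\<bar>\<close> for \<open>i > k\<close> and
  \<open>\<bar>p(\<theta>)\<bar> \<le> \<bar>q(\<lambda>\<^sub>i)\<bar>\<close> for \<open>i \<le> k\<close>, where \<open>\<lambda>\<^sub>i \<ge> \<theta>\<close>.

  Such a \<open>p\<close> (lemma \<open>real_rooted_minorant\<close>) arises from the complex factorization
  \<open>q(t) = \<Prod> (1 - w t)\<close> on replacing each \<open>w\<close> by \<open>max (Re w) (1 / \<theta>)\<close>, so that all roots
  lie in \<open>(0, \<theta>]\<close>. No factor grows in absolute value on \<open>[0, \<theta>]\<close>. At \<open>\<theta>\<close>, the new polynomial
  vanishes if one of its roots is \<open>\<theta>\<close>; otherwise \<open>\<theta>\<close> lies beyond all of them, so each factor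
  increases in absolute value from there on. When the roots of \<open>q\<close> are real and positive, those
  beyond \<open>\<theta>\<close> are thus pulled back to \<open>\<theta>\<close>, and the others stay.
\<close>

section \<open>Minorants of a polynomial normalized at the origin\<close>

lemma complex_factorization_at_0:
  fixes q :: "real poly"
  assumes "poly q 0 = 1"
  obtains w :: "nat \<Rightarrow> complex"
  where "\<And>t. complex_of_real (poly q t) = (\<Prod>i<degree q. 1 - w i * of_real t)"
proof -
  define P where "P = map_poly complex_of_real q"
  have deg: "degree P = degree q"
    unfolding P_def by (intro degree_map_poly) auto
  have ev: "poly P (of_real t) = of_real (poly q t)" for t
    unfolding P_def by (induction q) (auto simp: map_poly_pCons)
  obtain z where z: "smult (lead_coeff P) (\<Prod>i<degree P. [:- z i, 1:]) = P"
    by (rule complex_poly_decompose')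
  have P: "poly P t = lead_coeff P * (\<Prod>i<degree q. t - z i)" for t
    by (subst z[symmetric]) (simp add: poly_prod deg)
  have one: "lead_coeff P * (\<Prod>i<degree q. - z i) = 1"
    using P[of 0] ev[of 0] assms by simp
  then have "(\<Prod>i<degree q. - z i) \<noteq> 0"
    by (metis mult_zero_right zero_neq_one)
  then have nz: "z i \<noteq> 0" if "i < degree q" for i
    using that by auto
  have "complex_of_real (poly q t) = (\<Prod>i<degree q. 1 - inverse (z i) * of_real t)" for t
  proof -
    have "(\<Prod>i<degree q. of_real t - z i)
        = (\<Prod>i<degree q. (- z i) * (1 - inverse (z i) * of_real t))"
      by (intro prod.cong refl) (simp add: nz field_simps)
    then have "complex_of_real (poly q t) = (lead_coeff P * (\<Prod>i<degree q. - z i)) *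
        (\<Prod>i<degree q. 1 - inverse (z i) * of_real t)"
      using P[of "of_real t"] by (simp only: ev prod.distrib mult.assoc)
    then show ?thesis
      by (simp only: one mult_1_left)
  qed
  then show thesis
    by (rule that)
qed

text \<open>
  With \<open>u = max (Re w) (1 / \<theta>)\<close>, discarding the imaginary part of \<open>w\<close> can only shrink
  \<open>\<bar>1 - w t\<bar>\<close>; if moreover \<open>Re w < 1 / \<theta>\<close>, then raising it to \<open>1 / \<theta>\<close> shrinks the factor on
  \<open>[0, \<theta>]\<close>, where it stays nonnegative. Beyond \<open>\<theta>\<close>, the product of the \<open>u t - 1\<close> is increasing
  when all \<open>u > 1 / \<theta>\<close>, so its value at \<open>\<theta>\<close> is a lower bound there.
\<close>
lemma real_rooted_minorant:
  fixes q :: "real poly"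
  assumes q0: "poly q 0 = 1" and \<theta>: "\<theta> > 0"
  obtains u :: "nat \<Rightarrow> real"
  where "\<And>t. 0 \<le> t \<Longrightarrow> t \<le> \<theta> \<Longrightarrow> \<bar>\<Prod>i<degree q. 1 - u i * t\<bar> \<le> \<bar>poly q t\<bar>"
    and "\<And>t. \<theta> \<le> t \<Longrightarrow> \<bar>\<Prod>i<degree q. 1 - u i * \<theta>\<bar> \<le> \<bar>poly q t\<bar>"
proof -
  obtain w where w: "\<And>t. complex_of_real (poly q t) = (\<Prod>i<degree q. 1 - w i * of_real t)"
    using complex_factorization_at_0[OF q0] by metis
  define u where "u i = max (Re (w i)) (1 / \<theta>)" for i
  have abs_q: "\<bar>poly q t\<bar> = (\<Prod>i<degree q. cmod (1 - w i * of_real t))" for t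
    by (metis norm_of_real real_norm_def w prod_norm)
  have re: "\<bar>1 - Re (w i) * t\<bar> \<le> cmod (1 - w i * of_real t)" for i t
    using abs_Re_le_cmod[of "1 - w i * of_real t"] by simp
  show thesis
  proof (rule that[of u])
    fix t assume t: "0 \<le> t" "t \<le> \<theta>"
    have "\<bar>1 - u i * t\<bar> \<le> cmod (1 - w i * of_real t)" for i
    proof (cases "Re (w i) \<ge> 1 / \<theta>")
      case True
      then show ?thesis
        using re[of i t] by (simp add: u_def max_def)
    next
      case False
      then have "Re (w i) * t \<le> 1 / \<theta> * t" and "1 / \<theta> * t \<le> 1"
        using t \<theta> mult_right_mono[of "Re (w i)" "1 / \<theta>" t] by auto
      then show ?thesis
        using re[of i t] False by (simp add: u_def max_def)
    qed
    then show "\<bar>\<Prod>i<degree q. 1 - u i * t\<bar> \<le> \<bar>poly q t\<bar>"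
      unfolding abs_q abs_prod by (intro prod_mono) auto
  next
    fix t assume t: "\<theta> \<le> t"
    show "\<bar>\<Prod>i<degree q. 1 - u i * \<theta>\<bar> \<le> \<bar>poly q t\<bar>"
    proof (cases "\<exists>i<degree q. Re (w i) \<le> 1 / \<theta>")
      case True
      then obtain i where i: "i < degree q" "u i * \<theta> = 1"
        using \<theta> by (auto simp: u_def max_def)
      then have "(\<Prod>i<degree q. 1 - u i * \<theta>) = 0"
        by auto
      then show ?thesis
        by (simp only: abs_zero abs_ge_zero)
    next
      case False
      have "\<bar>1 - u i * \<theta>\<bar> \<le> cmod (1 - w i * of_real t)" if "i < degree q" for i
      proof -
        have gt: "Re (w i) > 1 / \<theta>"
          using False that by auto
        then have "Re (w i) > 0"
          using \<theta> by (meson less_trans zero_less_divide_1_iff)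
        then have "1 < Re (w i) * \<theta>" and "Re (w i) * \<theta> \<le> Re (w i) * t"
          using gt \<theta> t by (auto simp: field_simps)
        then show ?thesis
          using re[of i t] gt by (simp add: u_def max_def)
      qed
      then show ?thesis
        unfolding abs_q abs_prod by (intro prod_mono) auto
    qed
  qed
qed

section \<open>The conjugate gradient recurrence for symmetric operators\<close>

locale pcg_recurrence =
  fixes A F :: "'a::real_inner \<Rightarrow> 'a"
    and xstar :: 'a
    and x r p :: "nat \<Rightarrow> 'a"
    and \<rho> \<alpha> :: "nat \<Rightarrow> real"
  assumes linear_A: "linear A" and linear_F: "linear F"
    and sym_A: "\<And>u v. A u \<bullet> v = u \<bullet> A v"
    and sym_F: "\<And>u v. F u \<bullet> v = u \<bullet> F v"
    and r_0: "r 0 = A (xstar - x 0)"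
    and p_0: "p 0 = F (r 0)"
    and \<rho>_eq: "\<And>j. \<rho> j = r j \<bullet> F (r j)"
    and \<alpha>_eq: "\<And>j. \<alpha> j = \<rho> j / (A (p j) \<bullet> p j)"
    and x_Suc: "\<And>j. x (Suc j) = x j + \<alpha> j *\<^sub>R p j"
    and r_Suc: "\<And>j. r (Suc j) = r j - \<alpha> j *\<^sub>R A (p j)"
    and p_Suc: "\<And>j. p (Suc j) = F (r (Suc j)) + (\<rho> (Suc j) / \<rho> j) *\<^sub>R p j"
begin

lemma residual_eq: "r j = A (xstar - x j)"
proof (induction j)
  case (Suc j)
  have "A (xstar - x (Suc j)) = A ((xstar - x j) - \<alpha> j *\<^sub>R p j)"
    by (simp add: x_Suc algebra_simps)
  then show ?case
    by (simp add: Suc r_Suc linear_diff[OF linear_A] linear_scale[OF linear_A])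
qed (rule r_0)

text \<open>
  The functional \<open>c\<close> below takes a coordinate along an eigenvector of \<open>F A\<close> with eigenvalue
  \<open>\<mu>\<close>; one polynomial \<open>q\<close> serves all of them. The search directions are carried along in the
  induction: \<open>p j\<close> is a polynomial of degree at most \<open>j + 1\<close> in \<open>F A\<close>, without constant term, applied to
  the initial error.
\<close>
lemma error_poly:
  "\<exists>q. degree q \<le> j \<and> poly q 0 = 1 \<and>
     (\<forall>(c :: 'a \<Rightarrow> real) \<mu>. linear c \<and> (\<forall>v. c (F (A v)) = \<mu> * c v) \<longrightarrow>
        c (xstar - x j) = poly q \<mu> * c (xstar - x 0))"
proof -
  have "\<exists>q s. degree q \<le> j \<and> poly q 0 = 1 \<and> degree s \<le> Suc j \<and> poly s 0 = 0 \<and>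
     (\<forall>(c :: 'a \<Rightarrow> real) \<mu>. linear c \<and> (\<forall>v. c (F (A v)) = \<mu> * c v) \<longrightarrow>
        c (xstar - x j) = poly q \<mu> * c (xstar - x 0) \<and>
        c (p j) = poly s \<mu> * c (xstar - x 0))"
  proof (induction j)
    case 0
    show ?case
      by (intro exI[of _ "1 :: real poly"] exI[of _ "[:0, 1:] :: real poly"]) (simp add: p_0 r_0)
  next
    case (Suc j)
    then obtain q s where qs: "degree q \<le> j" "poly q 0 = 1" "degree s \<le> Suc j" "poly s 0 = 0"
      and c_qs: "\<And>(c :: 'a \<Rightarrow> real) \<mu>. linear c \<Longrightarrow> (\<forall>v. c (F (A v)) = \<mu> * c v) \<Longrightarrow>
        c (xstar - x j) = poly q \<mu> * c (xstar - x 0) \<and>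
        c (p j) = poly s \<mu> * c (xstar - x 0)"
      by blast
    define q' where "q' = q - smult (\<alpha> j) s"
    define s' where "s' = [:0, 1:] * q' + smult (\<rho> (Suc j) / \<rho> j) s"
    have deg_q': "degree q' \<le> Suc j"
      unfolding q'_def using qs
      by (intro degree_diff_le) (auto intro: order_trans[OF degree_smult_le])
    have "degree ([:0, 1:] * q') \<le> Suc (Suc j)"
      using deg_q' degree_pCons_le[of 0 q'] by simp
    then have deg_s': "degree s' \<le> Suc (Suc j)"
      unfolding s'_def using qs
      by (intro degree_add_le) (auto intro: order_trans[OF degree_smult_le])
    have "c (xstar - x (Suc j)) = poly q' \<mu> * c (xstar - x 0) \<and>
        c (p (Suc j)) = poly s' \<mu> * c (xstar - x 0)"
      if c: "linear c" and eig: "\<forall>v. c (F (A v)) = \<mu> * c v"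
      for c :: "'a \<Rightarrow> real" and \<mu>
    proof -
      have "xstar - x (Suc j) = (xstar - x j) - \<alpha> j *\<^sub>R p j"
        by (simp add: x_Suc)
      then have "c (xstar - x (Suc j)) = c (xstar - x j) - \<alpha> j * c (p j)"
        by (simp only: linear_diff[OF c] linear_scale[OF c]) simp
      then have err: "c (xstar - x (Suc j)) = poly q' \<mu> * c (xstar - x 0)"
        using c_qs[OF c eig] by (simp add: q'_def algebra_simps)
      have "c (p (Suc j)) = \<mu> * c (xstar - x (Suc j)) + \<rho> (Suc j) / \<rho> j * c (p j)"
        using eig by (simp add: p_Suc residual_eq linear_add[OF c] linear_scale[OF c])
      then show ?thesis
        using err c_qs[OF c eig] by (simp add: s'_def algebra_simps)
    qed
    then show ?case
      using deg_q' deg_s' qs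
      by (intro exI[of _ q'] exI[of _ s']) (auto simp: q'_def s'_def)
  qed
  then show ?thesis
    by blast
qed

end

locale pcg_recurrence_no_breakdown = pcg_recurrence +
  fixes m :: nat
  assumes \<rho>_nz: "\<And>j. j < m \<Longrightarrow> \<rho> j \<noteq> 0"
    and curvature_nz: "\<And>j. j < m \<Longrightarrow> A (p j) \<bullet> p j \<noteq> 0"
begin

lemma \<alpha>_nz: "j < m \<Longrightarrow> \<alpha> j \<noteq> 0"
  by (simp add: \<alpha>_eq \<rho>_nz curvature_nz)

lemma A_p_eq: "j < m \<Longrightarrow> A (p j) = (1 / \<alpha> j) *\<^sub>R (r j - r (Suc j))"
  by (simp add: r_Suc \<alpha>_nz)

text \<open>
  The two orthogonality relations feed each other: conjugacy of the directions keeps the new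
  residual orthogonal to the older ones, and this in turn makes \<open>F (r (j + 1))\<close> conjugate to all
  directions but the last, for which the coefficient of \<open>p j\<close> in \<open>p (j + 1)\<close> compensates.
\<close>
lemma conjugacy:
  assumes "j \<le> m"
  shows "(\<forall>i<j. r j \<bullet> p i = 0) \<and> (\<forall>i<j. A (p i) \<bullet> p j = 0) \<and> r j \<bullet> p j = \<rho> j"
  using assms
proof (induction j)
  case 0
  show ?case
    by (simp add: p_0 \<rho>_eq)
next
  case (Suc j)
  then have j: "j < m"
    by simp
  have IH: "\<And>i. i < j \<Longrightarrow> r j \<bullet> p i = 0" "\<And>i. i < j \<Longrightarrow> A (p i) \<bullet> p j = 0" "r j \<bullet> p j = \<rho> j"
    using Suc by auto
  have rp: "r (Suc j) \<bullet> p i = 0" if "i \<le> j" for i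
  proof (cases "i = j")
    case True
    then show ?thesis
      using IH(3) curvature_nz[OF j] by (simp add: r_Suc inner_diff_left \<alpha>_eq)
  next
    case False
    then show ?thesis
      using IH(1,2)[of i] that
      by (simp add: r_Suc inner_diff_left sym_A inner_commute[of "p j"])
  qed
  have rz: "r (Suc j) \<bullet> F (r i) = 0" if "i \<le> j" for i
  proof (cases i)
    case 0
    then show ?thesis
      using rp[of 0] p_0 by simp
  next
    case (Suc h)
    then have "F (r i) = p i - (\<rho> i / \<rho> h) *\<^sub>R p h"
      by (simp add: p_Suc)
    then show ?thesis
      using rp[of i] rp[of h] that Suc by (simp add: inner_diff_right)
  qed
  have Ap: "A (p i) \<bullet> F (r (Suc j)) = - (1 / \<alpha> i) * (r (Suc j) \<bullet> F (r (Suc i)))"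
    if "i \<le> j" for i
  proof -
    have "A (p i) \<bullet> F (r (Suc j))
        = (1 / \<alpha> i) * (F (r i) \<bullet> r (Suc j) - F (r (Suc i)) \<bullet> r (Suc j))"
      using A_p_eq[of i] that j by (simp add: inner_diff_left sym_F)
    then show ?thesis
      using rz[OF that] by (simp add: inner_commute)
  qed
  have "A (p i) \<bullet> p (Suc j) = 0" if "i \<le> j" for i
  proof (cases "i = j")
    case True
    have "A (p j) \<bullet> p (Suc j)
        = - (1 / \<alpha> j) * \<rho> (Suc j) + \<rho> (Suc j) / \<rho> j * (A (p j) \<bullet> p j)"
      using Ap[of j] by (simp add: p_Suc inner_add_right \<rho>_eq)
    also have "\<dots> = 0"
      using \<rho>_nz[OF j] curvature_nz[OF j] by (simp add: \<alpha>_eq)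
    finally show ?thesis
      using True by simp
  next
    case False
    then show ?thesis
      using Ap[of i] rz[of "Suc i"] IH(2)[of i] that by (simp add: p_Suc inner_add_right)
  qed
  moreover have "r (Suc j) \<bullet> p (Suc j) = \<rho> (Suc j)"
    using rp[of j] by (simp add: p_Suc inner_add_right \<rho>_eq)
  ultimately show ?case
    using rp by auto
qed

lemma F_residual_in_span: "F (r j) \<in> span (p ` {..j})"
proof (cases j)
  case 0
  then show ?thesis
    by (metis p_0 atMost_iff imageI order_refl span_base)
next
  case (Suc h)
  then have "F (r j) = p j - (\<rho> j / \<rho> h) *\<^sub>R p h"
    by (simp add: p_Suc)
  then show ?thesis
    using Suc by (simp add: span_diff span_scale span_base)
qed

lemma span_p_mono: "i \<le> j \<Longrightarrow> span (p ` {..<i}) \<subseteq> span (p ` {..<j})"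
  by (intro span_mono) auto

lemma F_A_in_span:
  assumes "v \<in> span (p ` {..<j})" "j \<le> m"
  shows "F (A v) \<in> span (p ` {..<Suc j})"
  using assms(1)
proof (induction rule: span_induct_alt)
  case base
  show ?case
    by (simp add: linear_0[OF linear_A] linear_0[OF linear_F] span_zero)
next
  case (step c y z)
  then obtain i where i: "i < j" "y = p i"
    by auto
  have "F (r i) \<in> span (p ` {..<Suc j})" and "F (r (Suc i)) \<in> span (p ` {..<Suc j})"
    using F_residual_in_span[of i] F_residual_in_span[of "Suc i"]
      span_p_mono[of "Suc i" "Suc j"] span_p_mono[of "Suc (Suc i)" "Suc j"] i(1)
    unfolding lessThan_Suc_atMost by auto
  moreover have "F (A y) = (1 / \<alpha> i) *\<^sub>R (F (r i) - F (r (Suc i)))"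
    using A_p_eq[of i] i assms(2) by (simp add: linear_scale[OF linear_F] linear_diff[OF linear_F])
  ultimately have "F (A y) \<in> span (p ` {..<Suc j})"
    by (simp add: span_diff span_scale)
  then show ?case
    using step
    by (simp add: linear_add[OF linear_A] linear_scale[OF linear_A]
        linear_add[OF linear_F] linear_scale[OF linear_F] span_add span_scale)
qed

text \<open>
  A polynomial in \<open>F A\<close> with value \<open>1\<close> at \<open>0\<close> and real roots, given by its linear factors
  \<open>1 - u i t\<close>, applied to the initial error.
\<close>
primrec factors_applied :: "(nat \<Rightarrow> real) \<Rightarrow> nat \<Rightarrow> 'a" where
  "factors_applied u 0 = xstar - x 0"
| "factors_applied u (Suc j) = factors_applied u j - u j *\<^sub>R F (A (factors_applied u j))"

lemma factors_applied_in_span: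
  "j \<le> m \<Longrightarrow> factors_applied u j - (xstar - x 0) \<in> span (p ` {..<j})"
proof (induction j)
  case (Suc j)
  let ?e = "xstar - x 0" and ?y = "factors_applied u j"
  have IH: "?y - ?e \<in> span (p ` {..<j})"
    using Suc by simp
  have "F (A ?y) = F (A (?y - ?e)) + p 0"
    by (simp add: p_0 r_0 linear_diff[OF linear_A] linear_diff[OF linear_F])
  moreover have "F (A (?y - ?e)) \<in> span (p ` {..<Suc j})"
    using F_A_in_span[OF IH] Suc.prems by simp
  moreover have "p 0 \<in> span (p ` {..<Suc j})"
    by (intro span_base) auto
  ultimately have "F (A ?y) \<in> span (p ` {..<Suc j})"
    by (simp add: span_add)
  moreover have "?y - ?e \<in> span (p ` {..<Suc j})"
    using IH span_p_mono[of j "Suc j"] by auto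
  ultimately have "(?y - ?e) - u j *\<^sub>R F (A ?y) \<in> span (p ` {..<Suc j})"
    by (metis span_diff span_scale)
  moreover have "factors_applied u (Suc j) - ?e = (?y - ?e) - u j *\<^sub>R F (A ?y)"
    by simp
  ultimately show ?case
    by metis
qed (simp add: span_zero)

lemma linear_factors_applied:
  assumes "linear c" "\<And>v. c (F (A v)) = \<mu> * c v"
  shows "c (factors_applied u j) = (\<Prod>i<j. 1 - u i * \<mu>) * c (xstar - x 0)"
proof (induction j)
  case (Suc j)
  have "c (factors_applied u (Suc j)) = (1 - u j * \<mu>) * c (factors_applied u j)"
    by (simp add: linear_diff[OF assms(1)] linear_scale[OF assms(1)] assms(2) algebra_simps)
  then show ?case
    by (simp only: Suc.IH prod.lessThan_Suc mult_ac)
qed simp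

lemma iterate_in_span: "j \<le> m \<Longrightarrow> x j - x 0 \<in> span (p ` {..<j})"
proof (induction j)
  case (Suc j)
  have "x j - x 0 \<in> span (p ` {..<Suc j})"
    using Suc span_p_mono[of j "Suc j"] by auto
  then have "(x j - x 0) + \<alpha> j *\<^sub>R p j \<in> span (p ` {..<Suc j})"
    by (intro span_add span_scale) (auto intro: span_base)
  then show ?case
    by (simp add: x_Suc algebra_simps)
qed (simp add: span_zero)

text \<open>
  The residual \<open>r m\<close> is orthogonal to all directions, so the error at step \<open>m\<close> is the
  \<open>A\<close>-orthogonal projection of the initial error off their span, and Pythagoras applies.
\<close>
lemma error_minimal:
  assumes pos: "\<And>v. 0 \<le> v \<bullet> A v" and j: "j \<le> m"
  shows "(xstar - x m) \<bullet> A (xstar - x m) \<le> factors_applied u j \<bullet> A (factors_applied u j)"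
proof -
  define err where "err = xstar - x m"
  define w where "w = factors_applied u j - err"
  have "w = (factors_applied u j - (xstar - x 0)) + (x m - x 0)"
    by (simp add: w_def err_def)
  moreover have "factors_applied u j - (xstar - x 0) \<in> span (p ` {..<m})"
    using factors_applied_in_span[OF j] span_p_mono[OF j] by blast
  ultimately have w: "w \<in> span (p ` {..<m})"
    using iterate_in_span[of m] by (metis order_refl span_add)
  have "orthogonal (r m) w"
    using w by (rule orthogonal_to_span) (use conjugacy[of m] in \<open>auto simp: orthogonal_def\<close>)
  then have "w \<bullet> A err = 0"
    by (simp add: err_def residual_eq[symmetric] orthogonal_def inner_commute)
  moreover have "err \<bullet> A w = w \<bullet> A err"
    by (metis inner_commute sym_A)
  moreover have "factors_applied u j = err + w"
    by (simp add: w_def)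
  ultimately have "factors_applied u j \<bullet> A (factors_applied u j) = err \<bullet> A err + w \<bullet> A w"
    by (simp add: linear_add[OF linear_A] inner_add_left inner_add_right)
  then show ?thesis
    using pos[of w] by (simp add: err_def)
qed

end

lemma matrix_sym_inner:
  fixes M :: "real ^ 'n ^ 'n"
  assumes "transpose M = M"
  shows "(M *v u) \<bullet> v = u \<bullet> (M *v v)"
  by (metis assms dot_lmul_matrix transpose_matrix_vector)

lemma pcg_recurrence_pcg:
  fixes A F :: "real ^ 'n ^ 'n"
  assumes A: "transpose A = A" and F: "transpose F = F" and b: "A *v xstar = b"
  shows "pcg_recurrence ((*v) A) ((*v) F) xstar
    (pcg_iterate A b x0 F)
    (\<lambda>j. fst (snd (pcg A b x0 F j)))
    (\<lambda>j. snd (snd (snd (pcg A b x0 F j))))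
    (\<lambda>j. fst (snd (snd (pcg A b x0 F j))))
    (\<lambda>j. fst (snd (snd (pcg A b x0 F j))) /
      ((A *v snd (snd (snd (pcg A b x0 F j)))) \<bullet> snd (snd (snd (pcg A b x0 F j)))))"
proof -
  have pcg_0: "pcg A b x0 F 0 = pcg_init A b x0 F"
    and pcg_Suc: "pcg A b x0 F (Suc j) = pcg_step A F (pcg A b x0 F j)" for j
    by (simp_all add: pcg_def)
  have \<rho>: "fst (snd (snd (pcg A b x0 F j)))
      = fst (snd (pcg A b x0 F j)) \<bullet> (F *v fst (snd (pcg A b x0 F j)))" for j
    by (cases j)
      (auto simp: pcg_0 pcg_Suc pcg_init_def pcg_step_def Let_def split: prod.splits)
  show ?thesis
    by (rule pcg_recurrence.intro)
      ((rule matrix_vector_mul_linear matrix_sym_inner[OF A] matrix_sym_inner[OF F] \<rho> refl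
        | simp add: pcg_0 pcg_Suc pcg_init_def pcg_step_def pcg_iterate_def Let_def
            case_prod_beta b matrix_vector_mult_diff_distrib)+)
qed

section \<open>Matrices diagonal in the eigenbasis\<close>

lemma conj_diag_entry:
  "(S ** diag_matrix d ** transpose S) $ a $ c = (\<Sum>i\<in>UNIV. d $ i * (S $ a $ i * S $ c $ i))"
proof -
  have "(S ** diag_matrix d) $ a $ i = S $ a $ i * d $ i" for i
    by (simp add: matrix_matrix_mult_def diag_matrix_def if_distrib if_distribR sum.delta
        cong: if_cong)
  then show ?thesis
    by (simp add: matrix_matrix_mult_def[of "S ** diag_matrix d"] transpose_def mult_ac)
qed

lemma transpose_conj_diag:
  "transpose (S ** diag_matrix d ** transpose S) = S ** diag_matrix d ** transpose S"
  by (simp add: vec_eq_iff transpose_def[of "S ** diag_matrix d ** transpose S"]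
      conj_diag_entry mult.commute)

lemma diag_matrix_mult_vec: "(diag_matrix d *v v) $ i = d $ i * v $ i"
  by (simp add: matrix_vector_mult_def diag_matrix_def if_distrib if_distribR sum.delta'
      cong: if_cong)

lemma transpose_mult_vec_nth: "(transpose S *v v) $ i = column i S \<bullet> v"
  by (simp add: matrix_mult_dot row_def column_def transpose_def del: transpose_matrix_vector)

lemma column_inner_conj_diag:
  fixes S :: "real ^ 'n ^ 'n"
  assumes "orthogonal_matrix S"
  shows "column i S \<bullet> ((S ** diag_matrix d ** transpose S) *v v) = d $ i * (column i S \<bullet> v)"
proof -
  have "transpose S ** (S ** diag_matrix d ** transpose S) = diag_matrix d ** transpose S"
    using assms by (simp add: matrix_mul_assoc orthogonal_matrix_def)
  then have "transpose S *v ((S ** diag_matrix d ** transpose S) *v v)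
      = diag_matrix d *v (transpose S *v v)"
    by (metis matrix_vector_mul_assoc)
  then show ?thesis
    by (metis diag_matrix_mult_vec transpose_mult_vec_nth)
qed

lemma parseval_columns:
  fixes S :: "real ^ 'n ^ 'n"
  assumes "orthogonal_matrix S"
  shows "u \<bullet> v = (\<Sum>i\<in>UNIV. (column i S \<bullet> u) * (column i S \<bullet> v))"
proof -
  have "(transpose S *v u) \<bullet> (transpose S *v v) = u \<bullet> ((S ** transpose S) *v v)"
    by (metis dot_lmul_matrix transpose_matrix_vector matrix_vector_mul_assoc)
  also have "\<dots> = u \<bullet> v"
    using assms by (simp add: orthogonal_matrix_def)
  finally show ?thesis
    by (simp add: inner_vec_def[of "transpose S *v u"] transpose_mult_vec_nth
        del: transpose_matrix_vector)
qed

lemma conj_diag_quadratic_form: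
  fixes S :: "real ^ 'n ^ 'n"
  assumes "orthogonal_matrix S"
  shows "v \<bullet> ((S ** diag_matrix d ** transpose S) *v v)
    = (\<Sum>i\<in>UNIV. d $ i * (column i S \<bullet> v)\<^sup>2)"
  by (subst parseval_columns[OF assms])
    (simp add: column_inner_conj_diag[OF assms] power2_eq_square mult_ac)

lemma pos_def_mult_matrix_inv:
  fixes A :: "real ^ 'n ^ 'n"
  assumes "pos_def_matrix A"
  shows "A *v (matrix_inv A *v b) = b"
proof -
  have "\<forall>x. A *v x = 0 \<longrightarrow> x = 0"
    using assms unfolding pos_def_matrix_def by (metis inner_zero_right less_irrefl)
  then have "invertible A"
    by (metis matrix_left_invertible_ker invertible_left_inverse)
  then have "A ** matrix_inv A = mat 1"
    unfolding invertible_def matrix_inv_def by (rule someI2_ex) auto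
  then show ?thesis
    by (simp add: matrix_vector_mul_assoc)
qed

lemma rank_diag_matrix_le:
  fixes d :: "real ^ 'n"
  assumes "\<And>i. i \<notin> I \<Longrightarrow> d $ i = 0"
  shows "rank (diag_matrix d) \<le> card I"
proof -
  let ?B = "(\<lambda>i. axis i (1::real)) ` I"
  have "diag_matrix d *v v \<in> span ?B" for v
  proof -
    have "diag_matrix d *v v = (\<Sum>i\<in>UNIV. (d $ i * v $ i) *s axis i 1)"
      by (subst basis_expansion[symmetric]) (simp add: diag_matrix_mult_vec)
    also have "\<dots> \<in> span ?B"
    proof (rule span_sum)
      fix i
      show "(d $ i * v $ i) *s axis i 1 \<in> span ?B"
        by (cases "i \<in> I")
          (auto simp: assms scalar_mult_eq_scaleR intro: span_base span_scale span_zero)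
    qed
    finally show ?thesis .
  qed
  then have "rank (diag_matrix d) \<le> card ?B"
    unfolding rank_dim_range by (intro dim_le_card) auto
  also have "\<dots> \<le> card I"
    by (rule card_image_le) simp
  finally show ?thesis .
qed

lemma scaled_precond_eq_conj_diag:
  fixes S :: "real ^ 'n ^ 'n"
  assumes inj: "inj_on e {1..k}"
    and d: "d = (\<chi> i. if i \<in> e ` {1..k} then \<theta> / lam $ i - 1 else 0)"
  shows "scaled_precond S lam e k \<theta> = mat 1 + S ** diag_matrix d ** transpose S"
proof -
  have "(\<Sum>i = 1..k. (\<theta> / lam $ e i - 1) *\<^sub>R outer_prod (column (e i) S) (column (e i) S)) $ a $ c
      = (S ** diag_matrix d ** transpose S) $ a $ c" for a c
  proof -
    have "(\<Sum>i = 1..k. (\<theta> / lam $ e i - 1) * (S $ a $ e i * S $ c $ e i))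
        = (\<Sum>i\<in>e ` {1..k}. (\<theta> / lam $ i - 1) * (S $ a $ i * S $ c $ i))"
      by (subst sum.reindex[OF inj]) simp
    also have "\<dots> = (\<Sum>i\<in>UNIV. d $ i * (S $ a $ i * S $ c $ i))"
      by (rule sum.mono_neutral_cong_left) (auto simp: d)
    finally show ?thesis
      by (simp add: conj_diag_entry sum_component outer_prod_def column_def)
  qed
  then show ?thesis
    by (simp add: scaled_precond_def vec_eq_iff)
qed

lemma feasible_scaled_precond:
  fixes S :: "real ^ 'n ^ 'n"
  assumes inj: "inj_on e {1..k}" and lam: "\<And>i. lam $ i > 0" and \<theta>: "\<theta> > 0"
  shows "feasible_precond S k (scaled_precond S lam e k \<theta>)"
proof -
  define d where "d = (\<chi> i. if i \<in> e ` {1..k} then \<theta> / lam $ i - 1 else 0)"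
  have d_pos: "1 + d $ i > 0" for i
    using lam[of i] \<theta> by (simp add: d_def)
  have diag: "mat 1 + diag_matrix d = diag_matrix (\<chi> i. 1 + d $ i)"
    by (simp add: vec_eq_iff mat_def diag_matrix_def)
  have "pos_def_matrix (mat 1 + diag_matrix d)"
    unfolding diag pos_def_matrix_def
  proof (intro conjI allI impI)
    show "transpose (diag_matrix (\<chi> i. 1 + d $ i)) = diag_matrix (\<chi> i. 1 + d $ i)"
      by (auto simp: vec_eq_iff transpose_def diag_matrix_def)
    fix v :: "real ^ 'n"
    assume "v \<noteq> 0"
    then obtain i where i: "v $ i \<noteq> 0"
      by (auto simp: vec_eq_iff)
    have "(\<Sum>i\<in>UNIV. (1 + d $ i) * (v $ i)\<^sup>2) > 0"
      by (rule sum_pos2[where i = i]) (use i d_pos in \<open>auto simp: less_imp_le\<close>)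
    then show "0 < v \<bullet> (diag_matrix (\<chi> i. 1 + d $ i) *v v)"
      by (simp add: inner_vec_def diag_matrix_mult_vec power2_eq_square mult_ac)
  qed
  moreover have "rank (diag_matrix d) \<le> k"
    using rank_diag_matrix_le[of "e ` {1..k}" d] card_image[OF inj] by (simp add: d_def)
  ultimately show ?thesis
    unfolding feasible_precond_def scaled_precond_eq_conj_diag[OF inj d_def] by blast
qed

section \<open>Comparison of the preconditioned and the plain iteration\<close>

theorem theorem4p6:
  fixes A S :: "real ^ 'n ^ 'n"
    and lam b x0 xstar :: "real ^ 'n"
    and e :: "nat \<Rightarrow> 'n"
    and k l :: nat
    and \<theta> :: real
  assumes "pos_def_matrix A"
    and "ordered_spectral_decomp A S lam e"
    and "xstar = matrix_inv A *v b"
    and "1 < k" and "k < CARD('n)"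
    and "is_arg_min (\<lambda>j. lam $ e j / lam $ e (CARD('n) - k + j - 1))
           (\<lambda>j. 1 \<le> j \<and> j \<le> k + 1) (k + 1)"
    and "1 \<le> l"
    and "\<And>F. feasible_precond S k F \<Longrightarrow> pcg_not_converged A b x0 F l"
    and "lam $ e (k + 1) \<le> \<theta>" and "\<theta> \<le> lam $ e k"
  shows "norm_wrt A (xstar - pcg_iterate A b x0 (scaled_precond S lam e k \<theta>) l)
       \<le> norm_wrt A (xstar - cg_iterate A b x0 l)"
proof -
  have bij: "bij_betw e {1..CARD('n)} UNIV" and S: "orthogonal_matrix S"
    and A: "A = S ** diag_matrix lam ** transpose S"
    and ord: "\<And>i j. 1 \<le> i \<Longrightarrow> i \<le> j \<Longrightarrow> j \<le> CARD('n) \<Longrightarrow> lam $ e j \<le> lam $ e i"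
    and lam: "\<And>i. lam $ i > 0"
    using assms(2) by (auto simp: ordered_spectral_decomp_def)
  have \<theta>: "\<theta> > 0"
    using lam[of "e (k + 1)"] assms(9) by linarith
  have inj: "inj_on e {1..k}"
    using bij assms(5) by (auto simp: bij_betw_def intro: inj_on_subset)
  define I where "I = e ` {1..k}"
  have large: "\<theta> \<le> lam $ i" if "i \<in> I" for i
  proof -
    obtain h where "i = e h" "1 \<le> h" "h \<le> k"
      using \<open>i \<in> I\<close> by (auto simp: I_def)
    then show ?thesis
      using ord[of h k] assms(5,10) by simp
  qed
  have small: "lam $ i \<le> \<theta>" if "i \<notin> I" for i
  proof -
    obtain h where h: "h \<in> {1..CARD('n)}" "i = e h"
      using bij by (metis UNIV_I bij_betw_imp_surj_on imageE)
    then have "h > k"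
      using that by (force simp: I_def)
    then show ?thesis
      using ord[of "k + 1" h] h assms(9) by simp
  qed
  define F where "F = scaled_precond S lam e k \<theta>"
  define d where "d = (\<chi> i. if i \<in> e ` {1..k} then \<theta> / lam $ i - 1 else 0)"
  have F: "F = mat 1 + S ** diag_matrix d ** transpose S"
    unfolding F_def by (rule scaled_precond_eq_conj_diag[OF inj d_def])
  have sym_A: "transpose A = A"
    using assms(1) by (simp add: pos_def_matrix_def)
  have sym_F: "transpose F = F"
  proof -
    have "transpose (mat 1 + M) = mat 1 + transpose M" for M :: "real ^ 'n ^ 'n"
      by (simp add: vec_eq_iff transpose_def mat_def)
    then show ?thesis
      by (simp add: F transpose_conj_diag)
  qed
  have b: "A *v xstar = b"
    using pos_def_mult_matrix_inv[OF assms(1)] assms(3) by simp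
  \<comment> \<open>\<open>F\<close> is feasible, so the hypothesis on feasible preconditioners rules out a breakdown.\<close>
  have defined: "pcg_iterates_defined A b x0 F l"
    using assms(8)[OF feasible_scaled_precond[OF inj lam \<theta>]]
    by (simp add: F_def pcg_not_converged_def)
  define r where "r = (\<lambda>j. fst (snd (pcg A b x0 F j)))"
  define p where "p = (\<lambda>j. snd (snd (snd (pcg A b x0 F j))))"
  define \<rho> where "\<rho> = (\<lambda>j. fst (snd (snd (pcg A b x0 F j))))"
  have rec: "pcg_recurrence ((*v) A) ((*v) F) xstar (pcg_iterate A b x0 F) r p \<rho>
      (\<lambda>j. \<rho> j / ((A *v p j) \<bullet> p j))"
    unfolding r_def p_def \<rho>_def by (rule pcg_recurrence_pcg[OF sym_A sym_F b])
  interpret P: pcg_recurrence_no_breakdown "(*v) A" "(*v) F" xstar "pcg_iterate A b x0 F"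
    r p \<rho> "\<lambda>j. \<rho> j / ((A *v p j) \<bullet> p j)" l
    by (intro pcg_recurrence_no_breakdown.intro rec pcg_recurrence_no_breakdown_axioms.intro)
      (use defined in \<open>auto simp: pcg_iterates_defined_def p_def \<rho>_def case_prod_beta\<close>)
  have sym_1: "transpose (mat 1 :: real ^ 'n ^ 'n) = mat 1"
    by (rule transpose_mat)
  interpret C: pcg_recurrence "(*v) A" "(*v) (mat 1)" xstar "pcg_iterate A b x0 (mat 1)"
    "\<lambda>j. fst (snd (pcg A b x0 (mat 1) j))"
    "\<lambda>j. snd (snd (snd (pcg A b x0 (mat 1) j)))"
    "\<lambda>j. fst (snd (snd (pcg A b x0 (mat 1) j)))"
    "\<lambda>j. fst (snd (snd (pcg A b x0 (mat 1) j))) /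
      ((A *v snd (snd (snd (pcg A b x0 (mat 1) j))))
        \<bullet> snd (snd (snd (pcg A b x0 (mat 1) j))))"
    by (rule pcg_recurrence_pcg[OF sym_A sym_1 b])
  define c where "c i v = column i S \<bullet> v" for i and v :: "real ^ 'n"
  have linear_c: "linear (c i)" for i
    unfolding c_def by (simp add: linear_iff inner_add_right)
  have c_A: "c i (A *v v) = lam $ i * c i v" for i v
    unfolding c_def A by (rule column_inner_conj_diag[OF S])
  \<comment> \<open>The spectrum of \<open>F A\<close>: the \<open>k\<close> largest eigenvalues of \<open>A\<close> are moved to \<open>\<theta>\<close>.\<close>
  define \<mu> where "\<mu> i = (if i \<in> I then \<theta> else lam $ i)" for i
  have c_FA: "c i (F *v (A *v v)) = \<mu> i * c i v" for i v
  proof -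
    have "c i (F *v w) = (1 + d $ i) * c i w" for w
      unfolding F c_def matrix_vector_mult_add_rdistrib inner_add_right
        column_inner_conj_diag[OF S]
      by (simp add: algebra_simps)
    then have "c i (F *v (A *v v)) = (1 + d $ i) * lam $ i * c i v"
      by (simp add: c_A)
    also have "(1 + d $ i) * lam $ i = \<mu> i"
      using lam[of i] by (simp add: \<mu>_def d_def I_def)
    finally show ?thesis .
  qed
  have norm_A: "v \<bullet> (A *v v) = (\<Sum>i\<in>UNIV. lam $ i * (c i v)\<^sup>2)" for v
    unfolding c_def A by (rule conj_diag_quadratic_form[OF S])
  have pos: "0 \<le> v \<bullet> (A *v v)" for v
    unfolding norm_A using lam by (intro sum_nonneg) (simp add: less_imp_le)
  have x_0: "pcg_iterate A b x0 G 0 = x0" for G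
    by (simp add: pcg_iterate_def pcg_def pcg_init_def Let_def)
  obtain q where q: "degree q \<le> l" "poly q 0 = 1"
    and c_q: "\<forall>(c :: real ^ 'n \<Rightarrow> real) \<mu>. linear c \<and> (\<forall>v. c (mat 1 *v (A *v v)) = \<mu> * c v) \<longrightarrow>
      c (xstar - pcg_iterate A b x0 (mat 1) l)
        = poly q \<mu> * c (xstar - pcg_iterate A b x0 (mat 1) 0)"
    using C.error_poly[of l] by blast
  have c_cg: "c i (xstar - cg_iterate A b x0 l) = poly q (lam $ i) * c i (xstar - x0)" for i
    using c_q[rule_format, of "c i" "lam $ i"] linear_c c_A by (simp add: cg_iterate_def x_0)
  obtain u
    where u_small: "\<And>t. 0 \<le> t \<Longrightarrow> t \<le> \<theta> \<Longrightarrow> \<bar>\<Prod>h<degree q. 1 - u h * t\<bar> \<le> \<bar>poly q t\<bar>"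
      and u_large: "\<And>t. \<theta> \<le> t \<Longrightarrow> \<bar>\<Prod>h<degree q. 1 - u h * \<theta>\<bar> \<le> \<bar>poly q t\<bar>"
    using real_rooted_minorant[OF q(2) \<theta>] by blast
  define y where "y = P.factors_applied u (degree q)"
  have "\<bar>c i y\<bar> \<le> \<bar>c i (xstar - cg_iterate A b x0 l)\<bar>" for i
  proof -
    have "\<bar>\<Prod>h<degree q. 1 - u h * \<mu> i\<bar> \<le> \<bar>poly q (lam $ i)\<bar>"
      using u_large[OF large, of i] u_small[OF _ small, of i] lam[of i]
      by (auto simp: \<mu>_def)
    then show ?thesis
      unfolding y_def P.linear_factors_applied[OF linear_c c_FA] c_cg x_0 abs_mult
      by (rule mult_right_mono) simp
  qed
  then have "(c i y)\<^sup>2 \<le> (c i (xstar - cg_iterate A b x0 l))\<^sup>2" for i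
    by (simp add: abs_le_square_iff)
  then have "y \<bullet> (A *v y)
      \<le> (xstar - cg_iterate A b x0 l) \<bullet> (A *v (xstar - cg_iterate A b x0 l))"
    unfolding norm_A using lam by (intro sum_mono mult_left_mono) (auto simp: less_imp_le)
  then show ?thesis
    using P.error_minimal[OF pos q(1), of u]
    unfolding norm_wrt_def F_def[symmetric] y_def by simp
qed

end
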